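(* Let $X$ be a non-negative random variable with $\mathbb{E}X\in(0,\infty)$, and let $c\in(0,\infty)$. Assume that $X$ admits a $c$-bounded size bias coupling. Then the moment generating function of $X$ is finite everywhere, that is, $M(\beta):=\mathbb{E}\,e^{\beta X}<\infty$ for all $\beta\in\mathbb{R}$.
   Context: For a non-negative random variable $X$ with $0<\mathbb{E}X<\infty$, a random variable $Y$ is said to have the size biased distribution of $X$, written $Y=^d X^*$, if $\mathbb{P}(Y\in dx)/\mathbb{P}(X\in dx)=x/\mathbb{E}X$ (Radon–Nikodym derivative), i.e. $\mathbb{E}\,g(Y)=\mathbb{E}(Xg(X))/\mathbb{E}X$ for all bounded measurable $g$. A coupling of $X$ and $Y$ is a realization of random variables with the distributions of $X$ and $Y$ on a common probability space. We say that $X$ admits a $c$-bounded size bias coupling if there is a coupling of $X$ with $Y=^dX^*$ in which $Y\le X+c$ almost surely. *)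

theory Defs
  imports "HOL-Probability.Probability"
begin

text \<open>Meant for almost surely non-negative, integrable \<open>X\<close> with positive mean: then \<open>ennreal\<close> truncates
  nothing and this is the law with Radon-Nikodym derivative \<open>x / E X\<close> with respect to that of \<open>X\<close>.\<close>

definition size_biased_distr :: "'a measure \<Rightarrow> ('a \<Rightarrow> real) \<Rightarrow> real measure" where
  "size_biased_distr M X = density (distr M borel X) (\<lambda>x. ennreal (x / integral\<^sup>L M X))"

definition is_coupling ::
    "real measure \<Rightarrow> real measure \<Rightarrow> 'b measure \<Rightarrow> ('b \<Rightarrow> real) \<Rightarrow> ('b \<Rightarrow> real) \<Rightarrow> bool" where
  "is_coupling \<mu> \<nu> N U V \<longleftrightarrow>
     prob_space N \<and> U \<in> borel_measurable N \<and> V \<in> borel_measurable N \<and>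
     distr N borel U = \<mu> \<and> distr N borel V = \<nu>"

text \<open>HOL cannot quantify existentially over types, so the type of the sample space carrying
  the coupling is an explicit parameter. A theorem assuming this predicate for an arbitrary
  type covers couplings on any sample space.\<close>

definition admits_bounded_size_bias_coupling ::
    "'b itself \<Rightarrow> 'a measure \<Rightarrow> ('a \<Rightarrow> real) \<Rightarrow> real \<Rightarrow> bool" where
  "admits_bounded_size_bias_coupling (_ :: 'b itself) M X c \<longleftrightarrow>
     (\<exists>(N :: 'b measure) U V.
        is_coupling (distr M borel X) (size_biased_distr M X) N U V \<and>
        (AE \<omega> in N. V \<omega> \<le> U \<omega> + c))"

definition moment_generating_function :: "'a measure \<Rightarrow> ('a \<Rightarrow> real) \<Rightarrow> real \<Rightarrow> ennreal" where
  "moment_generating_function M X \<beta> = (\<integral>\<^sup>+ \<omega>. ennreal (exp (\<beta> * X \<omega>)) \<partial>M)"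

end

theory Submission
  imports Defs
begin

text \<open>
  Write \<open>a = E X\<close> and let \<open>V\<close> have the size biased law, coupled with a copy \<open>U\<close> of \<open>X\<close> so that
  \<open>V \<le> U + c\<close>. For a bounded increasing \<open>g\<close>, the size bias identity turns the coupling into a moment
  inequality: \<open>E (X g(X)) = a E g(V) \<le> a E g(U + c)\<close>. Applied to an exponential, which a shift by
  \<open>c\<close> multiplies by at most a constant, it says that \<open>E (X g(X)) \<le> D E g(X)\<close> with
  \<open>D = a exp(\<beta> c)\<close>. Hence little of \<open>E g(X)\<close> comes from large values of \<open>X\<close>: by Markov's inequality
  for the measure with density \<open>g(X)\<close>, the part from \<open>X > 2 D\<close> is at most half of \<open>E g(X)\<close>. The other
  part is at most \<open>exp(2 \<beta> D)\<close>, so \<open>E g(X) \<le> 2 exp(2 \<beta> D)\<close>.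

  Absorbing the half into the left side requires \<open>E g(X) < \<infinity>\<close>. So the argument is run with the
  truncated exponential \<open>g(x) = exp(\<beta> min(x, n))\<close>; since the bound does not depend on \<open>n\<close>, monotone
  convergence removes the truncation. Negative \<open>\<beta>\<close> are dominated by \<open>\<bar>\<beta>\<bar>\<close> because \<open>X \<ge> 0\<close>.
\<close>

lemma integral_size_biased_distr:
  fixes X :: "'a \<Rightarrow> real" and g :: "real \<Rightarrow> real"
  assumes X: "X \<in> borel_measurable M" "AE \<omega> in M. 0 \<le> X \<omega>"
    and mean: "0 < integral\<^sup>L M X"
    and g: "g \<in> borel_measurable borel"
  shows "integral\<^sup>L (size_biased_distr M X) g = (\<integral>\<omega>. X \<omega> * g (X \<omega>) \<partial>M) / integral\<^sup>L M X"
proof -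
  have nonneg: "AE x in distr M borel X. 0 \<le> x / integral\<^sup>L M X"
    using X mean by (subst AE_distr_iff) (auto elim!: eventually_mono)
  have "integral\<^sup>L (size_biased_distr M X) g
      = (\<integral>x. (x / integral\<^sup>L M X) * g x \<partial>distr M borel X)"
    unfolding size_biased_distr_def by (subst integral_density) (use g nonneg in auto)
  also have "\<dots> = (\<integral>\<omega>. (X \<omega> / integral\<^sup>L M X) * g (X \<omega>) \<partial>M)"
    using X g by (subst integral_distr) auto
  finally show ?thesis by simp
qed

lemma expectation_truncated_exp_size_bias_le:
  fixes X :: "'a \<Rightarrow> real" and c \<beta> n :: real
  assumes X: "X \<in> borel_measurable M" "AE \<omega> in M. 0 \<le> X \<omega>"
    and mean: "0 < integral\<^sup>L M X"
    and c: "0 < c" and \<beta>: "0 \<le> \<beta>"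
    and coupling: "admits_bounded_size_bias_coupling TYPE('b) M X c"
  shows "(\<integral>\<omega>. X \<omega> * exp (\<beta> * min (X \<omega>) n) \<partial>M)
    \<le> integral\<^sup>L M X * exp (\<beta> * c) * (\<integral>\<omega>. exp (\<beta> * min (X \<omega>) n) \<partial>M)"
proof -
  define g where "g x = exp (\<beta> * min x n)" for x :: real
  have g[measurable]: "g \<in> borel_measurable borel"
    unfolding g_def by measurable
  obtain N :: "'b measure" and U V where N: "prob_space N"
    and UV[measurable]: "U \<in> borel_measurable N" "V \<in> borel_measurable N"
    and U: "distr N borel U = distr M borel X" and V: "distr N borel V = size_biased_distr M X"
    and le: "AE \<omega> in N. V \<omega> \<le> U \<omega> + c"
    using coupling unfolding admits_bounded_size_bias_coupling_def is_coupling_def by blast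
  interpret N: prob_space N by (rule N)
  have bounded: "norm (g x) \<le> exp (\<beta> * n)" for x
    using \<beta> by (auto simp: g_def intro!: mult_left_mono)
  have int: "integrable N (\<lambda>\<omega>. g (W \<omega>))" if [measurable]: "W \<in> borel_measurable N" for W
    by (rule N.integrable_const_bound[where B = "exp (\<beta> * n)"]) (use bounded in auto)
  have shift: "g v \<le> exp (\<beta> * c) * g u" if "v \<le> u + c" for u v
  proof -
    have "min v n \<le> c + min u n" using that c by auto
    then have "\<beta> * min v n \<le> \<beta> * c + \<beta> * min u n"
      using \<beta> by (metis distrib_left mult_left_mono)
    then show ?thesis by (simp add: g_def flip: exp_add)
  qed
  have "(\<integral>\<omega>. X \<omega> * g (X \<omega>) \<partial>M) / integral\<^sup>L M X = (\<integral>\<omega>. g (V \<omega>) \<partial>N)"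
    using integral_size_biased_distr[OF X mean g] by (simp add: integral_distr flip: V)
  also have "\<dots> \<le> (\<integral>\<omega>. exp (\<beta> * c) * g (U \<omega>) \<partial>N)"
    by (intro integral_mono_AE integrable_mult_right int UV) (use le shift in auto)
  also have "\<dots> = exp (\<beta> * c) * (\<integral>x. g x \<partial>distr N borel U)"
    by (simp add: integral_distr)
  also have "\<dots> = exp (\<beta> * c) * (\<integral>\<omega>. g (X \<omega>) \<partial>M)"
    unfolding U using X by (simp add: integral_distr)
  finally show ?thesis
    using mean by (simp add: g_def field_simps)
qed

text \<open>The right side is independent of the truncation level \<open>n\<close>. The threshold \<open>K\<close> is twice the
  constant of the preceding inequality, which leaves a factor \<open>1/2\<close> to absorb.\<close>

lemma expectation_truncated_exp_le:
  fixes M :: "'a measure" and X :: "'a \<Rightarrow> real" and c \<beta> n :: real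
  defines "K \<equiv> 2 * (integral\<^sup>L M X * exp (\<beta> * c))"
  assumes M: "prob_space M"
    and X: "X \<in> borel_measurable M" "AE \<omega> in M. 0 \<le> X \<omega>" "integrable M X"
    and mean: "0 < integral\<^sup>L M X"
    and c: "0 < c" and \<beta>: "0 \<le> \<beta>"
    and coupling: "admits_bounded_size_bias_coupling TYPE('b) M X c"
  shows "integrable M (\<lambda>\<omega>. exp (\<beta> * min (X \<omega>) n))"
    and "(\<integral>\<omega>. exp (\<beta> * min (X \<omega>) n) \<partial>M) \<le> 2 * exp (\<beta> * K)"
proof -
  interpret prob_space M by (rule M)
  note X(1)[measurable]
  define g where "g \<omega> = exp (\<beta> * min (X \<omega>) n)" for \<omega>
  have g[measurable]: "g \<in> borel_measurable M"
    unfolding g_def by measurable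
  have g_le: "g \<omega> \<le> exp (\<beta> * n)" and g_pos: "0 \<le> g \<omega>" for \<omega>
    using \<beta> by (auto simp: g_def intro!: mult_left_mono)
  have int: "integrable M g"
    by (rule integrable_const_bound[where B = "exp (\<beta> * n)"]) (use g_le g_pos in auto)
  then show "integrable M (\<lambda>\<omega>. exp (\<beta> * min (X \<omega>) n))"
    by (simp add: g_def[abs_def])
  have intX: "integrable M (\<lambda>\<omega>. X \<omega> * g \<omega>)"
    by (rule Bochner_Integration.integrable_bound[where f = "\<lambda>\<omega>. X \<omega> * exp (\<beta> * n)"])
      (use X g_le g_pos in \<open>auto simp: abs_mult intro!: mult_left_mono\<close>)
  have K: "0 < K" using mean by (simp add: K_def)
  have split: "g \<omega> \<le> exp (\<beta> * K) + X \<omega> * g \<omega> / K" if "0 \<le> X \<omega>" for \<omega>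
  proof (cases "X \<omega> \<le> K")
    case True
    then have "g \<omega> \<le> exp (\<beta> * K)"
      using \<beta> by (auto simp: g_def intro!: mult_left_mono)
    then show ?thesis using that K g_pos[of \<omega>] by (simp add: add_increasing2)
  next
    case False
    then have "K * g \<omega> \<le> X \<omega> * g \<omega>"
      using g_pos by (intro mult_right_mono) auto
    then have "g \<omega> \<le> X \<omega> * g \<omega> / K"
      using K by (simp add: field_simps)
    then show ?thesis by (simp add: add_increasing)
  qed
  have "(\<integral>\<omega>. g \<omega> \<partial>M) \<le> (\<integral>\<omega>. exp (\<beta> * K) + X \<omega> * g \<omega> / K \<partial>M)"
    by (intro integral_mono_AE int) (use intX X(2) split in auto)
  also have "\<dots> = exp (\<beta> * K) + (\<integral>\<omega>. X \<omega> * g \<omega> \<partial>M) / K"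
    using intX by (simp add: prob_space)
  also have "\<dots> \<le> exp (\<beta> * K) + (K / 2 * (\<integral>\<omega>. g \<omega> \<partial>M)) / K"
    using expectation_truncated_exp_size_bias_le[OF X(1,2) mean c \<beta> coupling, of n] K
    by (intro add_left_mono divide_right_mono) (auto simp: g_def K_def)
  finally have "(\<integral>\<omega>. g \<omega> \<partial>M) \<le> 2 * exp (\<beta> * K)"
    using K by simp
  then show "(\<integral>\<omega>. exp (\<beta> * min (X \<omega>) n) \<partial>M) \<le> 2 * exp (\<beta> * K)"
    by (simp add: g_def)
qed

lemma moment_generating_function_finite_nonneg:
  fixes X :: "'a \<Rightarrow> real" and c \<beta> :: real
  assumes M: "prob_space M"
    and X: "X \<in> borel_measurable M" "AE \<omega> in M. 0 \<le> X \<omega>" "integrable M X"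
    and mean: "0 < integral\<^sup>L M X"
    and c: "0 < c" and \<beta>: "0 \<le> \<beta>"
    and coupling: "admits_bounded_size_bias_coupling TYPE('b) M X c"
  shows "moment_generating_function M X \<beta> < \<infinity>"
proof -
  note X(1)[measurable]
  define B where "B = 2 * exp (\<beta> * (2 * (integral\<^sup>L M X * exp (\<beta> * c))))"
  define f where "f n \<omega> = ennreal (exp (\<beta> * min (X \<omega>) (real n)))" for n \<omega>
  have bound: "integral\<^sup>N M (f n) \<le> ennreal B" for n
    using expectation_truncated_exp_le[OF assms, of "real n"]
    by (simp add: f_def[abs_def] B_def nn_integral_eq_integral ennreal_leI)
  have "(\<lambda>n. integral\<^sup>N M (f n)) \<longlonglongrightarrow> moment_generating_function M X \<beta>"
    unfolding moment_generating_function_def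
  proof (rule nn_integral_LIMSEQ)
    show "incseq f"
      using \<beta> by (auto simp: incseq_def le_fun_def f_def intro!: ennreal_leI mult_left_mono)
    show "f n \<in> borel_measurable M" for n
      unfolding f_def by measurable
    show "(\<lambda>n. f n \<omega>) \<longlonglongrightarrow> ennreal (exp (\<beta> * X \<omega>))" for \<omega>
    proof (rule tendsto_eventually)
      obtain m where "X \<omega> \<le> real m" using real_arch_simple by blast
      then show "\<forall>\<^sub>F n in sequentially. f n \<omega> = ennreal (exp (\<beta> * X \<omega>))"
        by (intro eventually_sequentiallyI[of m]) (auto simp: f_def min_absorb1)
    qed
  qed
  then have "moment_generating_function M X \<beta> \<le> ennreal B"
    by (rule LIMSEQ_le_const2) (use bound in blast)
  then show ?thesis
    by (simp add: le_less_trans)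
qed

theorem corollary2p1:
  fixes M :: "'a measure" and X :: "'a \<Rightarrow> real" and c :: real
  assumes "prob_space M"
    and "X \<in> borel_measurable M"
    and "AE \<omega> in M. 0 \<le> X \<omega>"
    and "integrable M X"
    and "0 < integral\<^sup>L M X"
    and "0 < c"
    and "admits_bounded_size_bias_coupling TYPE('b) M X c"
  shows "\<forall>\<beta>::real. moment_generating_function M X \<beta> < \<infinity>"
proof
  fix \<beta> :: real
  have "moment_generating_function M X \<beta> \<le> moment_generating_function M X \<bar>\<beta>\<bar>"
    unfolding moment_generating_function_def using assms(3)
    by (intro nn_integral_mono_AE) (auto elim!: eventually_mono intro!: ennreal_leI mult_right_mono)
  also have "\<dots> < \<infinity>"
    by (rule moment_generating_function_finite_nonneg[OF assms(1-6) _ assms(7)]) simp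
  finally show "moment_generating_function M X \<beta> < \<infinity>" .
qed

end
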